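(* Let $q=p^n$ with $p$ prime and $n\in\mathbb{Z}^+$, let $\chi$ be a generator of the cyclic group $\widehat{\mathbb{F}_q^{\times}}$ of multiplicative characters of $\mathbb{F}_q$, let $k$ be a positive integer with $k\mid q-1$, and let $m=(q-1)/k$. Define the $m\times m$ matrices $$A_q(k)=\left[G_q(\chi^{ki+kj})\right]_{0\le i,j\le m-1},\qquad B_q(k)=\left[G_q(\chi^{ki+kj})^{-1}\right]_{0\le i,j\le m-1}.$$ Then: (i) $\det A_q(k)\in\mathbb{Z}$ and $\det B_q(k)\in\mathbb{Q}$, and both determinants are independent of the choice of the generator $\chi$. (ii) $\det A_q(k)\equiv (-1)^{\frac{m^2-m+2}{2}}\pmod p$.
   Context: For any multiplicative character $\psi$ of $\mathbb{F}_q$ we set $\psi(0)=0$ (in particular the trivial character $\varepsilon$ satisfies $\varepsilon(0)=0$). Let $\zeta_p=e^{2\pi i/p}$ and $\mathrm{Tr}=\mathrm{Tr}_{\mathbb{F}_q/\mathbb{F}_p}$, $\mathrm{Tr}(x)=\sum_{j=0}^{n-1}x^{p^j}$. The Gauss sum is $G_q(\psi)=\sum_{x\in\mathbb{F}_q}\psi(x)\zeta_p^{\mathrm{Tr}(x)}$. Powers $\chi^r$ are taken for arbitrary integers $r$ in the group of characters. *)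

theory Defs
  imports Complex_Main "Jordan_Normal_Form.Determinant"
begin

definition mult_char :: "('a::field \<Rightarrow> complex) \<Rightarrow> bool" where
  "mult_char \<psi> \<longleftrightarrow> \<psi> 0 = 0 \<and> (\<forall>x. x \<noteq> 0 \<longrightarrow> \<psi> x \<noteq> 0)
     \<and> (\<forall>x y. x \<noteq> 0 \<longrightarrow> y \<noteq> 0 \<longrightarrow> \<psi> (x * y) = \<psi> x * \<psi> y)"

definition char_pow :: "('a::field \<Rightarrow> complex) \<Rightarrow> int \<Rightarrow> ('a \<Rightarrow> complex)" where
  "char_pow \<chi> r = (\<lambda>x. if x = 0 then 0 else \<chi> x powi r)"

definition char_generator :: "('a::field \<Rightarrow> complex) \<Rightarrow> bool" where
  "char_generator \<chi> \<longleftrightarrow> mult_char \<chi> \<and> (\<forall>\<psi>. mult_char \<psi> \<longrightarrow> (\<exists>r::int. \<psi> = char_pow \<chi> r))"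

definition trace :: "nat \<Rightarrow> nat \<Rightarrow> 'a::field \<Rightarrow> 'a" where
  "trace p n x = (\<Sum>j<n. x ^ (p ^ j))"

text \<open>zeta_p^(Tr x): Tr x lies in the prime field, i.e. equals of_nat t with t < p.\<close>
definition add_char :: "nat \<Rightarrow> nat \<Rightarrow> 'a::field \<Rightarrow> complex" where
  "add_char p n x = exp (2 * pi * \<i> * of_nat (THE t. t < p \<and> of_nat t = trace p n x) / of_nat p)"

definition gauss_sum :: "nat \<Rightarrow> nat \<Rightarrow> ('a::{finite,field} \<Rightarrow> complex) \<Rightarrow> complex" where
  "gauss_sum p n \<psi> = (\<Sum>x\<in>UNIV. \<psi> x * add_char p n x)"

definition A_mat :: "nat \<Rightarrow> nat \<Rightarrow> nat \<Rightarrow> ('a::{finite,field} \<Rightarrow> complex) \<Rightarrow> complex mat" where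
  "A_mat p n k \<chi> = (let m = (p ^ n - 1) div k in
     mat m m (\<lambda>(i, j). gauss_sum p n (char_pow \<chi> (int (k * i + k * j)))))"

definition B_mat :: "nat \<Rightarrow> nat \<Rightarrow> nat \<Rightarrow> ('a::{finite,field} \<Rightarrow> complex) \<Rightarrow> complex mat" where
  "B_mat p n k \<chi> = (let m = (p ^ n - 1) div k in
     mat m m (\<lambda>(i, j). inverse (gauss_sum p n (char_pow \<chi> (int (k * i + k * j))))))"

end

theory Submission
  imports Defs "HOL-Number_Theory.Residues"
begin

text \<open>
  Write \<open>\<eta> z\<close> for the Gauss period over the fiber of \<open>\<chi> ^ k\<close> above an \<open>m\<close>-th root of unity \<open>z\<close>.
  The entries of \<open>A\<close> are the power sums of weight \<open>\<eta>\<close> over the \<open>m\<close>-th roots of unity; since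
  \<open>G(\<psi>) G(\<psi>\<inverse>) = \<psi>(-1) q\<close> for nontrivial \<open>\<psi>\<close>, those of \<open>B\<close> are power sums of weight
  \<open>(m \<eta> + 1 - q) / (q m)\<close>, up to a permutation of the roots of unity. Factoring through the discrete
  Fourier transform, both determinants are, up to sign, \<open>m ^ m\<close> times the product of the weights.
  The Galois group of the \<open>p\<close>-th cyclotomic field permutes the Gauss periods, so the product of
  \<open>a \<eta> + b\<close> over all periods is an integer, and replacing \<open>\<zeta>\<close> by \<open>1\<close> shows that it is congruent to
  \<open>(a k + b) ^ m\<close> modulo \<open>p\<close>. Another generator \<open>\<chi>\<close> only permutes the periods.
\<close>

section \<open>Values of integer polynomials at roots of unity\<close>

lemma sum_powers_unity_root:
  fixes z :: complex
  assumes "z ^ n = 1"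
  shows "(\<Sum>a<n. z ^ a) = (if z = 1 then of_nat n else 0)"
  using assms by (simp add: geometric_sum)

text \<open>Here \<open>x\<close> is a rational \<open>u / v\<close> in lowest terms, and
  \<open>v ^ j\<close> divides \<open>N\<close> for every \<open>j\<close>. Taking
  \<open>j = N\<close> forces \<open>v = 1\<close>, because \<open>N < 2 ^ N\<close>.\<close>

lemma Ints_of_bounded_denominator_powers:
  fixes x :: complex
  assumes "N > 0" and int: "\<And>j. of_nat N * x ^ j \<in> \<int>"
  shows "x \<in> \<int>"
proof -
  obtain a where a: "of_nat N * x = of_int a"
    using int[of 1] by (auto elim: Ints_cases)
  define r :: rat where "r = of_int a / of_nat N"
  have x: "x = of_rat r"
    using a \<open>N > 0\<close> by (simp add: r_def of_rat_divide field_simps)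
  obtain u v where uv: "quotient_of r = (u, v)" by force
  have v0: "v > 0" and cop: "coprime u v" and r: "r = of_int u / of_int v"
    using uv by (auto intro: quotient_of_denom_pos quotient_of_coprime quotient_of_div)
  have dvd: "v ^ j dvd int N" for j
  proof -
    obtain b where "of_nat N * x ^ j = of_int b"
      using int[of j] by (auto elim: Ints_cases)
    hence "(of_rat (of_nat N * r ^ j) :: complex) = of_rat (of_int b)"
      by (simp add: x of_rat_mult of_rat_power)
    hence "of_nat N * r ^ j = of_int b"
      by (simp only: of_rat_eq_iff)
    hence "of_int (int N * u ^ j) = (of_int (b * v ^ j) :: rat)"
      using v0 by (simp add: r field_simps)
    hence "int N * u ^ j = b * v ^ j"
      by (simp only: of_int_eq_iff)
    hence "v ^ j dvd int N * u ^ j" by simp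
    moreover have "coprime (v ^ j) (u ^ j)" using cop by (simp add: coprime_commute)
    ultimately show ?thesis by (simp add: coprime_dvd_mult_left_iff)
  qed
  have "v = 1"
  proof (rule ccontr)
    assume "v \<noteq> 1"
    hence "v \<ge> 2" using v0 by simp
    have "int N < 2 ^ N" by simp
    also have "2 ^ N \<le> v ^ N" using \<open>v \<ge> 2\<close> by (intro power_mono) auto
    also have "v ^ N \<le> int N" using dvd[of N] \<open>N > 0\<close> by (intro zdvd_imp_le) auto
    finally show False by simp
  qed
  thus ?thesis by (simp add: x r)
qed

text \<open>Averaging over the conjugates replaces Galois theory: the sum of \<open>f (\<zeta> ^ a)\<close> over \<open>a < p\<close> is an
  integer multiple of \<open>p\<close>, and it equals \<open>f 1 + (p - 1) f \<zeta>\<close>. Applied to the powers of \<open>f\<close>, this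
  bounds the denominators of all powers of \<open>f \<zeta>\<close>.\<close>

lemma conjugation_invariant_value:
  fixes f :: "complex poly" and \<zeta> :: complex
  assumes p: "prime p" and root: "\<zeta> ^ p = 1" and coeffs: "\<And>i. poly.coeff f i \<in> \<int>"
    and inv: "\<And>a. 0 < a \<Longrightarrow> a < p \<Longrightarrow> poly f (\<zeta> ^ a) = poly f \<zeta>"
  obtains d :: int where "poly f \<zeta> = of_int d" "\<And>e. poly f 1 = of_int e \<Longrightarrow> [d = e] (mod int p)"
proof -
  have p2: "p \<ge> 2" using p by (rule prime_ge_2_nat)
  have avg: "\<exists>c::int. poly h 1 + of_nat (p - 1) * poly h \<zeta> = of_nat p * of_int c"
    if h: "\<And>i. poly.coeff h i \<in> \<int>" and h_inv: "\<And>a. 0 < a \<Longrightarrow> a < p \<Longrightarrow> poly h (\<zeta> ^ a) = poly h \<zeta>"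
    for h :: "complex poly"
  proof -
    have "(\<Sum>a<p. poly h (\<zeta> ^ a)) = poly h 1 + (\<Sum>a\<in>{..<p} - {0}. poly h (\<zeta> ^ a))"
      using p2 by (subst sum.remove[of _ 0]) auto
    also have "(\<Sum>a\<in>{..<p} - {0}. poly h (\<zeta> ^ a)) = (\<Sum>a\<in>{..<p} - {0}. poly h \<zeta>)"
      by (intro sum.cong) (auto intro: h_inv)
    also have "\<dots> = of_nat (p - 1) * poly h \<zeta>" using p2 by simp
    finally have 1: "(\<Sum>a<p. poly h (\<zeta> ^ a)) = poly h 1 + of_nat (p - 1) * poly h \<zeta>" .
    \<comment> \<open>After the exchange of sums, each coefficient is multiplied by a geometric sum
      over a \<open>p\<close>-th root of unity, which is \<open>p\<close> or 0. This yields the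
      factor \<open>p\<close>.\<close>
    have "(\<Sum>a<p. poly h (\<zeta> ^ a)) = (\<Sum>i\<le>degree h. poly.coeff h i * (\<Sum>a<p. (\<zeta> ^ i) ^ a))"
      unfolding poly_altdef sum_distrib_left
      by (subst sum.swap) (simp add: power_mult[symmetric] mult.commute)
    also have "\<dots> = (\<Sum>i\<le>degree h. poly.coeff h i * (if \<zeta> ^ i = 1 then of_nat p else 0))"
    proof -
      have "(\<zeta> ^ i) ^ p = 1" for i
        by (metis mult.commute power_mult power_one root)
      thus ?thesis by (simp only: sum_powers_unity_root)
    qed
    also have "\<dots> = of_nat p * (\<Sum>i\<le>degree h. if \<zeta> ^ i = 1 then poly.coeff h i else 0)"
      unfolding sum_distrib_left by (intro sum.cong) auto
    finally have 2: "(\<Sum>a<p. poly h (\<zeta> ^ a)) = of_nat p * (\<Sum>i\<le>degree h. if \<zeta> ^ i = 1 then poly.coeff h i else 0)" .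
    have "(\<Sum>i\<le>degree h. if \<zeta> ^ i = 1 then poly.coeff h i else 0) \<in> \<int>"
      by (intro Ints_sum) (auto simp: h)
    then obtain c where "(\<Sum>i\<le>degree h. if \<zeta> ^ i = 1 then poly.coeff h i else 0) = of_int c"
      by (elim Ints_cases)
    thus ?thesis using 1 2 by (intro exI[of _ c]) simp
  qed
  have poly_1: "poly h 1 \<in> \<int>" if "\<And>i. poly.coeff h i \<in> \<int>" for h :: "complex poly"
    unfolding poly_altdef by (intro Ints_sum Ints_mult Ints_power that) auto
  have coeff_pow: "poly.coeff (f ^ j) i \<in> \<int>" for i j
  proof (induction j arbitrary: i)
    case 0
    show ?case by (simp add: coeff_1)
  next
    case (Suc j)
    show ?case unfolding power_Suc coeff_mult by (intro Ints_sum Ints_mult coeffs Suc)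
  qed
  have "of_nat (p - 1) * poly f \<zeta> ^ j \<in> \<int>" for j
  proof -
    obtain c :: int where "poly (f ^ j) 1 + of_nat (p - 1) * poly (f ^ j) \<zeta> = of_nat p * of_int c"
      using avg[of "f ^ j"] coeff_pow inv by (auto simp: poly_power)
    hence "of_nat (p - 1) * poly f \<zeta> ^ j = of_nat p * of_int c - poly (f ^ j) 1"
      by (simp add: poly_power algebra_simps)
    also have "\<dots> \<in> \<int>" by (intro Ints_diff Ints_mult poly_1 coeff_pow) auto
    finally show ?thesis .
  qed
  from Ints_of_bounded_denominator_powers[OF _ this] have "poly f \<zeta> \<in> \<int>"
    using p2 by simp
  then obtain d where d: "poly f \<zeta> = of_int d" by (auto elim: Ints_cases)
  moreover have "[d = e] (mod int p)" if e: "poly f 1 = of_int e" for e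
  proof -
    obtain c :: int where "poly f 1 + of_nat (p - 1) * poly f \<zeta> = of_nat p * of_int c"
      using avg[of f] coeffs inv by auto
    hence "of_int (e + (int p - 1) * d) = (of_int (int p * c) :: complex)"
      using p2 by (simp add: e d of_nat_diff)
    hence "e + (int p - 1) * d = int p * c" by (simp only: of_int_eq_iff)
    hence "d - e = int p * (d - c)" by (simp add: algebra_simps)
    thus ?thesis by (simp add: cong_iff_dvd_diff)
  qed
  ultimately show ?thesis by (rule that)
qed

section \<open>Determinants of matrices of power sums\<close>

text \<open>Expansion along row 0 leaves only column \<open>n\<close>, with sign
  \<open>(-1) ^ n\<close> and the smaller antidiagonal matrix as minor.\<close>

lemma det_antidiagonal:
  "det (mat n n (\<lambda>(i, j). if i + j + 1 = n then 1 else 0)) = ((-1) ^ (n * (n - 1) div 2) :: 'a::comm_ring_1)"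
proof (induction n)
  case (Suc n)
  let ?J = "\<lambda>n. mat n n (\<lambda>(i, j). if i + j + 1 = n then 1 else 0) :: 'a mat"
  have del: "mat_delete (?J (Suc n)) 0 n = ?J n"
    by (rule eq_matI) (auto simp: mat_delete_def)
  have cof: "cofactor (?J (Suc n)) 0 n = (-1) ^ n * det (?J n)"
    unfolding cofactor_def del by simp
  have "det (?J (Suc n)) = (\<Sum>j<Suc n. ?J (Suc n) $$ (0, j) * cofactor (?J (Suc n)) 0 j)"
    by (rule laplace_expansion_row) auto
  also have "\<dots> = (\<Sum>j<Suc n. if j = n then cofactor (?J (Suc n)) 0 j else 0)"
    by (intro sum.cong) auto
  also have "\<dots> = (-1) ^ n * det (?J n)"
    using cof by (simp only: sum.delta finite_lessThan lessThan_iff lessI if_True)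
  also have "\<dots> = (-1) ^ (n + n * (n - 1) div 2)"
    by (simp only: Suc power_add)
  also have "n + n * (n - 1) div 2 = Suc n * (Suc n - 1) div 2"
    by (cases n) auto
  finally show ?case .
qed simp

lemma det_index_negation:
  assumes "m > 0"
  shows "det (mat m m (\<lambda>(i, j). if m dvd i + j then 1 else 0))
    = ((-1) ^ ((m - 1) * (m - 2) div 2) :: 'a::comm_ring_1)"
proof -
  let ?P = "mat m m (\<lambda>(i, j). if m dvd i + j then 1 else 0) :: 'a mat"
  \<comment> \<open>Once row 0 and column 0 are deleted, the original indices are
    \<open>Suc i\<close> and \<open>Suc j\<close>. Their sum lies strictly between 0 and
    \<open>2 * m\<close>, so \<open>m\<close> is its only possible multiple of
    \<open>m\<close>.\<close>
  have dvd_iff: "m dvd Suc (Suc (i + j)) \<longleftrightarrow> i + j + 1 = m - 1" if "i < m - 1" "j < m - 1" for i j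
  proof
    assume "m dvd Suc (Suc (i + j))"
    then obtain c where c: "Suc (Suc (i + j)) = m * c" by (elim dvdE)
    have "c \<noteq> 0" using c by (intro notI) simp
    moreover have "c < 2"
    proof (rule ccontr)
      assume "\<not> c < 2"
      hence "m * 2 \<le> m * c" by simp
      thus False using c that by linarith
    qed
    ultimately have "c = 1" by simp
    thus "i + j + 1 = m - 1" using c by simp
  qed (use assms in auto)
  have del: "mat_delete ?P 0 0 = mat (m - 1) (m - 1) (\<lambda>(i, j). if i + j + 1 = m - 1 then 1 else 0)"
    by (rule eq_matI) (simp_all add: mat_delete_def dvd_iff)
  have "det ?P = (\<Sum>j<m. ?P $$ (0, j) * cofactor ?P 0 j)"
    using assms by (intro laplace_expansion_row) auto
  also have "\<dots> = (\<Sum>j<m. if j = 0 then cofactor ?P 0 j else 0)"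
    using assms by (intro sum.cong) (auto dest: dvd_imp_le)
  also have "\<dots> = det (mat_delete ?P 0 0)"
    using assms by (simp add: cofactor_def)
  also have "\<dots> = (-1) ^ ((m - 1) * (m - 2) div 2)"
    unfolding del det_antidiagonal by (simp add: numeral_2_eq_2)
  finally show ?thesis .
qed

section \<open>Powers of a primitive root of unity\<close>

lemma cis_unity_power: "cis (2 * pi / real n) ^ a = cis (2 * pi * real a / real n)"
  by (simp add: DeMoivre mult_ac)

lemma bij_betw_cis_powers:
  assumes "n > 0"
  shows "bij_betw (\<lambda>a. cis (2 * pi / real n) ^ a) {..<n} {z. z ^ n = 1}"
  unfolding cis_unity_power by (rule bij_betw_roots_unity[OF assms])

lemma cis_unity_power_n:
  assumes "n > 0"
  shows "cis (2 * pi / real n) ^ n = 1"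
  using assms by (simp add: DeMoivre)

lemma cis_unity_power_mod:
  assumes "n > 0"
  shows "cis (2 * pi / real n) ^ (a mod n) = cis (2 * pi / real n) ^ a"
proof -
  let ?w = "cis (2 * pi / real n)"
  have "?w ^ a = ?w ^ (n * (a div n) + a mod n)" by simp
  also have "\<dots> = ?w ^ (a mod n)"
    unfolding power_add power_mult cis_unity_power_n[OF assms] by simp
  finally show ?thesis by simp
qed

lemma cis_unity_power_eq_iff:
  assumes "n > 0"
  shows "cis (2 * pi / real n) ^ a = cis (2 * pi / real n) ^ b \<longleftrightarrow> [a = b] (mod n)"
proof -
  let ?w = "cis (2 * pi / real n)"
  have "?w ^ a = ?w ^ b \<longleftrightarrow> ?w ^ (a mod n) = ?w ^ (b mod n)"
    using assms by (simp add: cis_unity_power_mod)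
  also have "\<dots> \<longleftrightarrow> a mod n = b mod n"
    using bij_betw_cis_powers[OF assms] assms by (auto simp: bij_betw_def inj_on_def)
  finally show ?thesis by (simp add: cong_def)
qed

lemma cis_unity_power_eq_1_iff:
  assumes "n > 0"
  shows "cis (2 * pi / real n) ^ a = 1 \<longleftrightarrow> n dvd a"
  using cis_unity_power_eq_iff[OF assms, of a 0] by (simp add: cong_0_iff)

lemma sum_powers_roots_unity:
  assumes "m > 0"
  shows "(\<Sum>z | z ^ m = 1. z ^ s) = (if m dvd s then of_nat m else (0 :: complex))"
proof -
  let ?w = "cis (2 * pi / real m)"
  have "(\<Sum>z | z ^ m = 1. z ^ s) = (\<Sum>a<m. (?w ^ a) ^ s)"
    by (rule sum.reindex_bij_betw[OF bij_betw_cis_powers[OF assms], symmetric])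
  also have "\<dots> = (\<Sum>a<m. (?w ^ s) ^ a)" by (simp add: power_mult[symmetric] mult.commute)
  also have "\<dots> = (if ?w ^ s = 1 then of_nat m else 0)"
    by (rule sum_powers_unity_root) (metis mult.commute power_mult power_one cis_unity_power_n[OF assms])
  finally show ?thesis by (simp add: cis_unity_power_eq_1_iff assms)
qed

text \<open>With \<open>V\<close> the symmetric matrix of the discrete Fourier transform and \<open>D\<close> the diagonal matrix
  of the values of \<open>h\<close>, the matrix is \<open>V * D * V\<close>, and \<open>V * V\<close> is \<open>m\<close> times the permutation matrix of
  negation modulo \<open>m\<close>.\<close>

lemma det_power_sum_matrix:
  fixes h :: "complex \<Rightarrow> complex"
  assumes "m > 0"
  shows "det (mat m m (\<lambda>(i, j). \<Sum>z | z ^ m = 1. z ^ (i + j) * h z))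
    = (-1) ^ ((m - 1) * (m - 2) div 2) * of_nat m ^ m * (\<Prod>z | z ^ m = 1. h z)"
proof -
  let ?w = "cis (2 * pi / real m)"
  define V where "V = mat m m (\<lambda>(i, l). (?w ^ l) ^ i)"
  define D where "D = mat m m (\<lambda>(i, l). if i = l then h (?w ^ l) else 0)"
  define P where "P = mat m m (\<lambda>(i, j). if m dvd i + j then 1 else (0 :: complex))"
  have dims [simp]: "V \<in> carrier_mat m m" "D \<in> carrier_mat m m" "P \<in> carrier_mat m m"
    by (auto simp: V_def D_def P_def)
  have sum_eq: "(\<Sum>z | z ^ m = 1. f z) = (\<Sum>l<m. f (?w ^ l))" for f :: "complex \<Rightarrow> complex"
    by (rule sum.reindex_bij_betw[OF bij_betw_cis_powers[OF assms], symmetric])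
  have swap: "(?w ^ i) ^ l = (?w ^ l) ^ i" for i l
    by (simp add: power_mult[symmetric] mult.commute)
  have V_ix: "V $$ (i, l) = (?w ^ l) ^ i" if "i < m" "l < m" for i l
    using that by (simp add: V_def)
  have V_ix': "V $$ (l, j) = (?w ^ l) ^ j" if "l < m" "j < m" for l j
    unfolding V_ix[OF that] by (rule swap)
  have mult_ix: "(X * Y) $$ (i, j) = (\<Sum>l<m. X $$ (i, l) * Y $$ (l, j))"
    if "X \<in> carrier_mat m m" "Y \<in> carrier_mat m m" "i < m" "j < m" for X Y :: "complex mat" and i j
    using that by (auto simp: scalar_prod_def atLeast0LessThan)
  have VD: "(V * D) $$ (i, j) = (?w ^ j) ^ i * h (?w ^ j)" if ij: "i < m" "j < m" for i j
  proof -
    have "(V * D) $$ (i, j) = (\<Sum>l<m. V $$ (i, l) * D $$ (l, j))"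
      by (rule mult_ix) (use ij in auto)
    also have "\<dots> = (\<Sum>l<m. if l = j then (?w ^ l) ^ i * h (?w ^ l) else 0)"
      using ij by (intro sum.cong refl) (auto simp: V_def D_def)
    also have "\<dots> = (?w ^ j) ^ i * h (?w ^ j)"
      using ij by simp
    finally show ?thesis .
  qed
  have "mat m m (\<lambda>(i, j). \<Sum>z | z ^ m = 1. z ^ (i + j) * h z) = V * D * V"
  proof (rule eq_matI)
    fix i j assume "i < dim_row (V * D * V)" "j < dim_col (V * D * V)"
    hence ij: "i < m" "j < m" by (auto simp: V_def)
    have "(V * D * V) $$ (i, j) = (\<Sum>l<m. (V * D) $$ (i, l) * V $$ (l, j))"
      by (rule mult_ix) (use ij mult_carrier_mat[of V m m D m] in auto)
    also have "\<dots> = (\<Sum>l<m. (?w ^ l) ^ (i + j) * h (?w ^ l))"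
    proof (intro sum.cong refl)
      fix l assume "l \<in> {..<m}"
      hence l: "l < m" by simp
      show "(V * D) $$ (i, l) * V $$ (l, j) = (?w ^ l) ^ (i + j) * h (?w ^ l)"
        unfolding VD[OF ij(1) l] V_ix'[OF l ij(2)] power_add by (simp only: mult_ac)
    qed
    also have "\<dots> = (\<Sum>z | z ^ m = 1. z ^ (i + j) * h z)"
      by (rule sum_eq[symmetric])
    finally show "mat m m (\<lambda>(i, j). \<Sum>z | z ^ m = 1. z ^ (i + j) * h z) $$ (i, j) = (V * D * V) $$ (i, j)"
      using ij by simp
  qed (auto simp: V_def)
  moreover have "V * V = of_nat m \<cdot>\<^sub>m P"
  proof (rule eq_matI)
    fix i j assume "i < dim_row (of_nat m \<cdot>\<^sub>m P)" "j < dim_col (of_nat m \<cdot>\<^sub>m P)"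
    hence ij: "i < m" "j < m" by (auto simp: P_def)
    have "(V * V) $$ (i, j) = (\<Sum>l<m. V $$ (i, l) * V $$ (l, j))"
      by (rule mult_ix) (use ij in auto)
    also have "\<dots> = (\<Sum>l<m. (?w ^ l) ^ (i + j))"
    proof (intro sum.cong refl)
      fix l assume "l \<in> {..<m}"
      hence l: "l < m" by simp
      show "V $$ (i, l) * V $$ (l, j) = (?w ^ l) ^ (i + j)"
        unfolding V_ix[OF ij(1) l] V_ix'[OF l ij(2)] power_add ..
    qed
    also have "\<dots> = (\<Sum>z | z ^ m = 1. z ^ (i + j))" by (rule sum_eq[symmetric])
    also have "\<dots> = (of_nat m \<cdot>\<^sub>m P) $$ (i, j)"
      using ij assms by (simp add: sum_powers_roots_unity P_def)
    finally show "(V * V) $$ (i, j) = (of_nat m \<cdot>\<^sub>m P) $$ (i, j)" .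
  qed (auto simp: V_def P_def)
  hence "det (V * V) = of_nat m ^ m * (-1) ^ ((m - 1) * (m - 2) div 2)"
    using det_index_negation[OF assms, where 'a = complex] by (simp add: P_def)
  \<comment> \<open>Only the square of \<open>det V\<close> enters, so the Vandermonde determinant
    itself need not be evaluated.\<close>
  hence "det V * det V = of_nat m ^ m * (-1) ^ ((m - 1) * (m - 2) div 2)"
    by (simp add: det_mult[of _ m])
  moreover have "det D = (\<Prod>z | z ^ m = 1. h z)"
  proof -
    have "det D = prod_list (diag_mat D)"
      by (rule det_upper_triangular[of _ m]) (auto simp: D_def upper_triangular_def)
    also have "\<dots> = (\<Prod>l<m. h (?w ^ l))"
      by (simp add: prod_list_diag_prod D_def atLeast0LessThan)
    also have "\<dots> = (\<Prod>z | z ^ m = 1. h z)"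
      by (rule prod.reindex_bij_betw[OF bij_betw_cis_powers[OF assms]])
    finally show ?thesis .
  qed
  moreover have "det (V * D * V) = det V * det V * det D"
    by (simp add: det_mult[of _ m] mult_carrier_mat[of V m m D m])
  ultimately show ?thesis by (simp only:) simp
qed

section \<open>Gauss sums over finite fields\<close>

text \<open>The type is repackaged as a ring record \<open>R\<close>, to which the theorem on cyclic
  multiplicative groups of finite fields in HOL-Algebra applies.\<close>

lemma finite_field_primitive_element:
  obtains g :: "'a::{finite,field}" where "g \<noteq> 0" "\<And>x. x \<noteq> 0 \<Longrightarrow> \<exists>i. x = g ^ i"
proof -
  define R where "R = (\<lparr>carrier = (UNIV :: 'a set), monoid.mult = (*), one = 1, zero = 0, add = (+)\<rparr> :: 'a ring)"
  have "\<exists>y. x + y = 0" for x :: 'a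
    by (rule exI[of _ "- x"]) simp
  moreover have "\<exists>y. x * y = 1" if "x \<noteq> 0" for x :: 'a
    using that by (intro exI[of _ "inverse x"]) simp
  ultimately interpret R: field R
    unfolding R_def using add.right_inverse
    by unfold_locales (auto simp: algebra_simps Units_def)
  have pow: "x [^]\<^bsub>R\<^esub> i = x ^ i" for x :: 'a and i :: nat
    by (induction i) (auto simp: R_def mult.commute)
  have carr: "carrier (mult_of R) = UNIV - {0}"
    by (simp add: R_def)
  have "finite (carrier R)" by (simp add: R_def)
  from R.finite_field_mult_group_has_gen[OF this] obtain g
    where g: "g \<in> carrier (mult_of R)" "carrier (mult_of R) = {g [^]\<^bsub>R\<^esub> i | i::nat. i \<in> UNIV}"
    by blast
  have "\<exists>i. x = g ^ i" if "x \<noteq> 0" for x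
  proof -
    have "x \<in> {g [^]\<^bsub>R\<^esub> i | i::nat. i \<in> UNIV}"
      unfolding g(2)[symmetric] carr using that by simp
    thus ?thesis unfolding pow by blast
  qed
  moreover have "g \<noteq> 0" using g(1) unfolding carr by simp
  ultimately show ?thesis using that by blast
qed

text \<open>Multiplication by \<open>x\<close> permutes the nonzero elements and hence preserves
  their product, which is nonzero.\<close>

lemma finite_field_power_card_minus_1:
  fixes x :: "'a::{finite,field}"
  assumes "x \<noteq> 0"
  shows "x ^ (card (UNIV :: 'a set) - 1) = 1"
proof -
  have "(\<Prod>y\<in>UNIV - {0}. x * y) = (\<Prod>y\<in>UNIV - {0}. y)"
    by (rule prod.reindex_bij_witness[of _ "\<lambda>y. y / x" "\<lambda>y. x * y"]) (use assms in auto)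
  hence "x ^ card (UNIV - {0 :: 'a}) * (\<Prod>y\<in>UNIV - {0}. y) = (\<Prod>y\<in>UNIV - {0}. y)"
    by (simp add: prod.distrib)
  moreover have "(\<Prod>y\<in>UNIV - {0 :: 'a}. y) \<noteq> 0" by simp
  ultimately show ?thesis by (simp add: card_Diff_singleton)
qed

section \<open>Multiplicative characters and injectivity of generators\<close>

lemma mult_char_1: "mult_char \<chi> \<Longrightarrow> \<chi> 1 = 1"
  unfolding mult_char_def by (metis mult_cancel_left1 mult_1 zero_neq_one)

lemma mult_char_power:
  assumes "mult_char \<chi>" "x \<noteq> 0"
  shows "\<chi> (x ^ i) = \<chi> x ^ i"
  by (induction i) (use assms mult_char_1[of \<chi>] in \<open>auto simp: mult_char_def\<close>)

lemma mult_char_unity_root: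
  fixes \<chi> :: "'a::{finite,field} \<Rightarrow> complex"
  assumes "mult_char \<chi>" "x \<noteq> 0"
  shows "\<chi> x ^ (card (UNIV :: 'a set) - 1) = 1"
  using mult_char_power[OF assms] finite_field_power_card_minus_1[OF assms(2)] mult_char_1[OF assms(1)]
  by metis

text \<open>The character sends a primitive element \<open>g\<close> to a primitive root of unity of
  the same order \<open>N\<close>.\<close>

lemma exists_injective_mult_char:
  "\<exists>\<psi> :: 'a::{finite,field} \<Rightarrow> complex. mult_char \<psi> \<and> inj_on \<psi> (UNIV - {0})"
proof -
  obtain g :: 'a where g0: "g \<noteq> 0" and g: "\<And>x. x \<noteq> 0 \<Longrightarrow> \<exists>i. x = g ^ i"
    by (rule finite_field_primitive_element) blast
  define N where "N = card (UNIV :: 'a set) - 1"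
  have cardU: "card (UNIV - {0 :: 'a}) = N" by (simp add: N_def card_Diff_singleton)
  have N: "N > 0"
    using cardU card_gt_0_iff[of "UNIV - {0 :: 'a}"] by (metis DiffI UNIV_I empty_iff finite singletonD zero_neq_one)
  have gN: "g ^ N = 1" unfolding N_def by (rule finite_field_power_card_minus_1[OF g0])
  have g_mod: "g ^ (i mod N) = g ^ i" for i
  proof -
    have "g ^ i = g ^ (N * (i div N) + i mod N)" by simp
    also have "\<dots> = g ^ (i mod N)" unfolding power_add power_mult gN by simp
    finally show ?thesis by simp
  qed
  have img: "(\<lambda>i. g ^ i) ` {..<N} = UNIV - {0}"
  proof
    show "UNIV - {0} \<subseteq> (\<lambda>i. g ^ i) ` {..<N}"
    proof
      fix x :: 'a assume "x \<in> UNIV - {0}"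
      then obtain i where "x = g ^ i" using g by auto
      hence "x = g ^ (i mod N)" by (simp add: g_mod)
      thus "x \<in> (\<lambda>i. g ^ i) ` {..<N}" using N by auto
    qed
  qed (use g0 in auto)
  have inj: "inj_on (\<lambda>i. g ^ i) {..<N}"
    by (rule eq_card_imp_inj_on) (auto simp: img cardU)
  have cong: "[i = j] (mod N)" if "g ^ i = g ^ j" for i j
  proof -
    have "g ^ (i mod N) = g ^ (j mod N)" using that by (simp add: g_mod)
    thus ?thesis using inj N by (auto simp: inj_on_def cong_def)
  qed
  \<comment> \<open>A discrete logarithm, determined only modulo \<open>N\<close>; this suffices
    because \<open>w\<close> below satisfies \<open>w ^ N = 1\<close>.\<close>
  define L where "L x = (SOME i. x = g ^ i)" for x
  have L: "g ^ L x = x" if "x \<noteq> 0" for x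
    unfolding L_def using someI_ex[OF g[OF that]] by simp
  define w where "w = cis (2 * pi / real N)"
  define \<psi> where "\<psi> x = (if x = 0 then 0 else w ^ L x)" for x
  have "mult_char \<psi>"
    unfolding mult_char_def
  proof (intro conjI allI impI)
    fix x y :: 'a assume xy: "x \<noteq> 0" "y \<noteq> 0"
    have "g ^ L (x * y) = g ^ (L x + L y)" using xy by (simp add: L power_add)
    hence "w ^ L (x * y) = w ^ (L x + L y)"
      unfolding w_def cis_unity_power_eq_iff[OF N] by (rule cong)
    thus "\<psi> (x * y) = \<psi> x * \<psi> y" using xy by (simp add: \<psi>_def power_add)
  qed (auto simp: \<psi>_def w_def)
  moreover have "inj_on \<psi> (UNIV - {0})"
  proof (rule inj_onI)
    fix x y assume "x \<in> UNIV - {0}" "y \<in> UNIV - {0}" "\<psi> x = \<psi> y"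
    hence xy: "x \<noteq> 0" "y \<noteq> 0" and "w ^ L x = w ^ L y" by (auto simp: \<psi>_def)
    hence "[L x = L y] (mod N)" using N by (simp add: w_def cis_unity_power_eq_iff)
    hence "g ^ L x = g ^ L y" by (metis cong_def g_mod)
    thus "x = y" using xy by (simp add: L)
  qed
  ultimately show ?thesis by blast
qed

text \<open>Some injective character is a power of \<open>\<chi>\<close>, and a power cannot
  separate points that \<open>\<chi>\<close> identifies.\<close>

lemma char_generator_inj:
  fixes \<chi> :: "'a::{finite,field} \<Rightarrow> complex"
  assumes "char_generator \<chi>"
  shows "inj_on \<chi> (UNIV - {0})"
proof (rule inj_onI)
  fix x y assume xy: "x \<in> UNIV - {0}" "y \<in> UNIV - {0}" "\<chi> x = \<chi> y"
  obtain \<psi> :: "'a \<Rightarrow> complex" where \<psi>: "mult_char \<psi>" "inj_on \<psi> (UNIV - {0})"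
    using exists_injective_mult_char by blast
  then obtain r where "\<psi> = char_pow \<chi> r"
    using assms unfolding char_generator_def by blast
  hence "\<psi> x = \<psi> y" using xy by (simp add: char_pow_def)
  thus "x = y" using \<psi>(2) xy by (auto dest: inj_onD)
qed

section \<open>The trace and the additive character\<close>

locale prime_power_field =
  fixes p n :: nat and F :: "'a::{finite,field} itself"
  assumes prime: "prime p" and n_pos: "n > 0" and card_UNIV: "card (UNIV :: 'a set) = p ^ n"
begin

abbreviation \<zeta> :: complex where "\<zeta> \<equiv> cis (2 * pi / real p)"

lemma p_ge_2: "p \<ge> 2"
  using prime by (rule prime_ge_2_nat)

lemma CHAR_eq: "CHAR('a) = p"
proof -
  have "prime CHAR('a)"
    by (rule prime_CHAR_semidom) (simp add: finite_imp_CHAR_pos)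
  moreover have "CHAR('a) dvd p ^ n"
    using CHAR_dvd_CARD[where 'a = 'a] by (simp add: card_UNIV)
  ultimately show ?thesis
    using prime by (metis prime_dvd_power primes_dvd_imp_eq)
qed

lemma power_card: "x ^ (p ^ n) = x" for x :: 'a
proof (cases "x = 0")
  case False
  have "x ^ (p ^ n) = x * x ^ (p ^ n - 1)"
    using p_ge_2 by (metis power_eq_if not_numeral_le_zero power_not_zero)
  thus ?thesis
    using finite_field_power_card_minus_1[OF False] by (simp add: card_UNIV)
qed (use p_ge_2 in auto)

lemma frobenius_add: "(x + y) ^ (p ^ j) = x ^ (p ^ j) + y ^ (p ^ j)" for x y :: 'a
  by (rule freshmans_dream') (simp_all add: CHAR_eq prime)

lemma trace_add: "trace p n (x + y) = trace p n x + trace p n (y :: 'a)"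
  by (simp add: trace_def frobenius_add sum.distrib)

text \<open>Frobenius permutes the summands cyclically, since
  \<open>x ^ (p ^ n) = x\<close>.\<close>

lemma trace_power_p: "trace p n x ^ p = trace p n (x :: 'a)"
proof -
  have "trace p n x ^ p = (\<Sum>j<n. (x ^ (p ^ j)) ^ p)"
    unfolding trace_def by (rule freshmans_dream_sum) (simp_all add: CHAR_eq prime)
  also have "\<dots> = (\<Sum>j<n. x ^ (p ^ Suc j))"
    by (simp add: power_mult[symmetric] mult.commute)
  also have "\<dots> = (\<Sum>j<Suc n. x ^ (p ^ j)) - x"
    unfolding sum.lessThan_Suc_shift by simp
  also have "\<dots> = trace p n x"
    by (simp add: trace_def power_card)
  finally show ?thesis .
qed

lemma of_nat_inj_on: "inj_on (of_nat :: nat \<Rightarrow> 'a) {..<p}"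
  by (rule inj_onI) (auto simp: of_nat_eq_iff_cong_CHAR CHAR_eq cong_def)

lemma of_nat_power_p: "(of_nat a :: 'a) ^ p = of_nat a"
proof (induction a)
  case (Suc a)
  thus ?case using frobenius_add[of 1 "of_nat a" 1] by simp
qed (use p_ge_2 in auto)

text \<open>The polynomial \<open>X ^ p - X\<close> has at most \<open>p\<close> roots, and the
  images of the naturals below \<open>p\<close> already provide \<open>p\<close> of them.\<close>

lemma frobenius_fixed:
  fixes y :: 'a
  assumes "y ^ p = y"
  shows "\<exists>t<p. of_nat t = y"
proof -
  define f :: "'a poly" where "f = Polynomial.monom 1 p - Polynomial.monom 1 1"
  have roots: "poly f x = 0 \<longleftrightarrow> x ^ p = x" for x by (simp add: f_def poly_monom)
  have "poly.coeff f p = 1" using p_ge_2 by (simp add: f_def)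
  hence "f \<noteq> 0" by auto
  hence "card {x. poly f x = 0} \<le> Polynomial.degree f" by (rule card_poly_roots_bound)
  also have "\<dots> \<le> p"
    unfolding f_def using p_ge_2 by (intro degree_diff_le) (auto intro: order.trans[OF degree_monom_le])
  also have "p = card ((of_nat :: nat \<Rightarrow> 'a) ` {..<p})"
    by (simp add: card_image of_nat_inj_on)
  finally have "of_nat ` {..<p} = {x. poly f x = 0}"
    by (intro card_seteq) (auto simp: roots of_nat_power_p)
  moreover have "y \<in> {x. poly f x = 0}" using assms by (simp add: roots)
  ultimately have "y \<in> of_nat ` {..<p}" by simp
  thus ?thesis by auto
qed

text \<open>The trace is a polynomial with linear coefficient 1 and degree at most
  \<open>p ^ (n - 1)\<close>, too small to vanish at all \<open>p ^ n\<close> elements.\<close>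

lemma trace_nonzero: "\<exists>x :: 'a. trace p n x \<noteq> 0"
proof (rule ccontr)
  assume *: "\<not> ?thesis"
  define f :: "'a poly" where "f = (\<Sum>j<n. Polynomial.monom 1 (p ^ j))"
  have "poly.coeff f 1 = (\<Sum>j<n. if j = 0 then 1 else 0)"
    unfolding f_def coeff_sum by (intro sum.cong) (use p_ge_2 in auto)
  hence "f \<noteq> 0" using n_pos by auto
  hence "card {x. poly f x = 0} \<le> Polynomial.degree f" by (rule card_poly_roots_bound)
  moreover have "{x. poly f x = 0} = UNIV"
    using * by (auto simp: f_def poly_sum poly_monom trace_def)
  moreover have "Polynomial.degree f \<le> p ^ (n - 1)"
    unfolding f_def using p_ge_2
    by (intro degree_sum_le) (auto intro!: order.trans[OF degree_monom_le] power_increasing)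
  ultimately have "p ^ n \<le> p ^ (n - 1)" by (simp add: card_UNIV)
  thus False using p_ge_2 n_pos by simp
qed

definition trace_nat :: "'a \<Rightarrow> nat" where
  "trace_nat x = (THE t. t < p \<and> of_nat t = trace p n x)"

lemma trace_nat: "trace_nat x < p" "of_nat (trace_nat x) = trace p n x"
proof -
  obtain t where t: "t < p" "of_nat t = trace p n x"
    using frobenius_fixed[OF trace_power_p] by blast
  have "trace_nat x < p \<and> of_nat (trace_nat x) = trace p n x"
    unfolding trace_nat_def
  proof (rule theI[of _ t])
    show "s = t" if "s < p \<and> of_nat s = trace p n x" for s
      using inj_onD[OF of_nat_inj_on, of s t] that t by simp
  qed (use t in auto)
  thus "trace_nat x < p" "of_nat (trace_nat x) = trace p n x" by auto
qed

lemma add_char_eq: "add_char p n x = \<zeta> ^ trace_nat x"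
proof -
  have "add_char p n x = exp (\<i> * of_real (2 * pi * real (trace_nat x) / real p))"
    unfolding add_char_def trace_nat_def[symmetric] by (simp add: field_simps)
  also have "\<dots> = \<zeta> ^ trace_nat x"
    unfolding cis_unity_power by (simp add: cis_conv_exp)
  finally show ?thesis .
qed

text \<open>Both sides express congruence modulo \<open>p\<close>. Identities between traces thereby
  transfer to powers of \<open>\<zeta>\<close>.\<close>

lemma zeta_power_eq_iff: "\<zeta> ^ a = \<zeta> ^ b \<longleftrightarrow> (of_nat a :: 'a) = of_nat b"
  using p_ge_2 by (simp add: cis_unity_power_eq_iff of_nat_eq_iff_cong_CHAR CHAR_eq)

lemma add_char_add: "add_char p n (x + y) = add_char p n x * add_char p n (y :: 'a)"
  unfolding add_char_eq power_add[symmetric] zeta_power_eq_iff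
  by (simp add: trace_nat trace_add)

lemma trace_of_nat_mult: "trace p n (of_nat a * x) = of_nat a * trace p n (x :: 'a)"
proof -
  have "(of_nat a :: 'a) ^ (p ^ j) = of_nat a" for j
    by (induction j) (simp_all add: power_mult mult.commute[of p] of_nat_power_p)
  thus ?thesis by (simp add: trace_def power_mult_distrib sum_distrib_left)
qed

text \<open>Conjugating \<open>\<zeta>\<close> to \<open>\<zeta> ^ a\<close> amounts to scaling the
  argument by \<open>a\<close>; this is how conjugation will act on Gauss periods.\<close>

lemma add_char_of_nat_mult: "add_char p n (of_nat a * x :: 'a) = (\<zeta> ^ a) ^ trace_nat x"
  unfolding add_char_eq power_mult[symmetric] zeta_power_eq_iff
  by (simp add: trace_nat trace_of_nat_mult)

text \<open>Translation by an element of nonzero trace multiplies the sum by a factor other than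
  1.\<close>

lemma sum_add_char: "(\<Sum>x\<in>UNIV. add_char p n (x :: 'a)) = 0"
proof -
  obtain y :: 'a where y: "trace p n y \<noteq> 0" using trace_nonzero by blast
  have "add_char p n y \<noteq> 1"
    using zeta_power_eq_iff[of "trace_nat y" 0] y by (simp add: add_char_eq trace_nat)
  moreover have "(\<Sum>x\<in>UNIV. add_char p n (x :: 'a)) = (\<Sum>x\<in>UNIV. add_char p n (x :: 'a)) * add_char p n y"
  proof -
    have "(\<Sum>x\<in>UNIV. add_char p n (x :: 'a)) = (\<Sum>x\<in>UNIV. add_char p n (x + y))"
      by (rule sum.reindex_bij_witness[of _ "\<lambda>x. x + y" "\<lambda>x. x - y"]) auto
    also have "\<dots> = (\<Sum>x\<in>UNIV. add_char p n (x :: 'a)) * add_char p n y"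
      by (simp only: add_char_add sum_distrib_right)
    finally show ?thesis .
  qed
  ultimately show ?thesis by simp
qed

lemma add_char_0: "add_char p n (0 :: 'a) = 1"
  using zeta_power_eq_iff[of "trace_nat 0" 0] p_ge_2 by (simp add: add_char_eq trace_nat trace_def power_0_left)

lemma sum_nonzero_add_char:
  "(\<Sum>x\<in>UNIV - {0}. add_char p n (c * x :: 'a)) = (if c = 0 then of_nat (p ^ n) - 1 else -1)"
proof (cases "c = 0")
  case True
  thus ?thesis
    using p_ge_2 by (simp add: add_char_0 card_Diff_singleton card_UNIV of_nat_diff)
next
  case False
  have "(\<Sum>x\<in>UNIV - {0}. add_char p n (c * x)) = (\<Sum>x\<in>UNIV - {0 :: 'a}. add_char p n x)"
    by (rule sum.reindex_bij_witness[of _ "\<lambda>x. x / c" "\<lambda>x. c * x"]) (use False in auto)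
  also have "\<dots> = -1"
    using sum_add_char sum.remove[of UNIV "0 :: 'a" "add_char p n"]
    by (simp add: add_char_0 eq_neg_iff_add_eq_0 add.commute)
  finally show ?thesis using False by simp
qed

section \<open>The product of the Gauss sums of a character and its inverse\<close>

lemma gauss_sum_nonzero:
  assumes "\<psi> 0 = 0"
  shows "gauss_sum p n \<psi> = (\<Sum>x\<in>UNIV - {0 :: 'a}. \<psi> x * add_char p n x)"
  unfolding gauss_sum_def using assms by (subst sum.remove[of _ 0]) auto

text \<open>Substituting \<open>x = t * y\<close> reduces the double sum to the sums of
  \<open>add_char p n ((t + 1) * y)\<close> over nonzero \<open>y\<close>. These are
  \<open>p ^ n - 1\<close> for \<open>t = -1\<close> and -1 otherwise, and the constant -1
  contributes nothing because the values of \<open>\<psi>\<close> sum to 0.\<close>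

lemma gauss_sum_mult_inverse:
  fixes \<psi> :: "'a \<Rightarrow> complex"
  assumes \<psi>: "mult_char \<psi>" and nontriv: "u \<noteq> 0" "\<psi> u \<noteq> 1"
  shows "gauss_sum p n \<psi> * gauss_sum p n (\<lambda>x. inverse (\<psi> x)) = \<psi> (-1) * of_nat (p ^ n)"
proof -
  let ?e = "add_char p n" and ?S = "UNIV - {0 :: 'a}"
  have \<psi>0: "\<psi> 0 = 0" and \<psi>_nz: "\<And>x. x \<noteq> 0 \<Longrightarrow> \<psi> x \<noteq> 0"
    and \<psi>_mult: "\<And>x y. x \<noteq> 0 \<Longrightarrow> y \<noteq> 0 \<Longrightarrow> \<psi> (x * y) = \<psi> x * \<psi> y"
    using \<psi> unfolding mult_char_def by blast+
  have sum0: "(\<Sum>t\<in>?S. \<psi> t) = 0"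
  proof -
    have "(\<Sum>t\<in>?S. \<psi> t) = (\<Sum>t\<in>?S. \<psi> (u * t))"
      by (rule sum.reindex_bij_witness[of _ "\<lambda>x. u * x" "\<lambda>x. x / u"]) (use nontriv in auto)
    also have "\<dots> = \<psi> u * (\<Sum>t\<in>?S. \<psi> t)"
      unfolding sum_distrib_left by (intro sum.cong) (auto simp: \<psi>_mult nontriv)
    finally show ?thesis using nontriv by simp
  qed
  have "gauss_sum p n \<psi> * gauss_sum p n (\<lambda>x. inverse (\<psi> x))
      = (\<Sum>x\<in>?S. \<Sum>y\<in>?S. (\<psi> x * ?e x) * (inverse (\<psi> y) * ?e y))"
    by (simp only: gauss_sum_nonzero \<psi>0 inverse_zero sum_product)
  also have "\<dots> = (\<Sum>y\<in>?S. \<Sum>x\<in>?S. (\<psi> x * ?e x) * (inverse (\<psi> y) * ?e y))"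
    by (rule sum.swap)
  also have "\<dots> = (\<Sum>y\<in>?S. \<Sum>t\<in>?S. \<psi> t * ?e ((t + 1) * y))"
  proof (rule sum.cong[OF refl])
    fix y :: 'a assume y: "y \<in> ?S"
    show "(\<Sum>x\<in>?S. (\<psi> x * ?e x) * (inverse (\<psi> y) * ?e y)) = (\<Sum>t\<in>?S. \<psi> t * ?e ((t + 1) * y))"
    proof (rule sum.reindex_bij_witness[of _ "\<lambda>t. t * y" "\<lambda>x. x / y"])
      fix x :: 'a assume x: "x \<in> ?S"
      have "\<psi> x = \<psi> (x / y * y)" using y by simp
      also have "\<dots> = \<psi> (x / y) * \<psi> y" by (rule \<psi>_mult) (use x y in auto)
      finally have split: "\<psi> x = \<psi> (x / y) * \<psi> y" .
      have "(\<psi> x * ?e x) * (inverse (\<psi> y) * ?e y) = (\<psi> (x / y) * \<psi> y * ?e x) * (inverse (\<psi> y) * ?e y)"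
        by (subst split) (rule refl)
      also have "\<dots> = \<psi> (x / y) * ?e (x + y)"
        using y \<psi>_nz[of y] by (simp add: add_char_add)
      also have "x + y = (x / y + 1) * y" using y by (simp add: field_simps)
      finally show "\<psi> (x / y) * ?e ((x / y + 1) * y) = (\<psi> x * ?e x) * (inverse (\<psi> y) * ?e y)" by (rule sym)
    qed (use y in auto)
  qed
  also have "\<dots> = (\<Sum>t\<in>?S. \<Sum>y\<in>?S. \<psi> t * ?e ((t + 1) * y))"
    by (rule sum.swap)
  also have "\<dots> = (\<Sum>t\<in>?S. \<psi> t * (if t + 1 = 0 then of_nat (p ^ n) - 1 else -1))"
    by (simp only: sum_distrib_left[symmetric] sum_nonzero_add_char)
  also have "\<dots> = (\<Sum>t\<in>?S. (if t = -1 then \<psi> t * of_nat (p ^ n) else 0) - \<psi> t)"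
  proof (intro sum.cong refl)
    fix t :: 'a
    have "t + 1 = 0 \<longleftrightarrow> t = -1" by (rule eq_neg_iff_add_eq_0[symmetric])
    thus "\<psi> t * (if t + 1 = 0 then of_nat (p ^ n) - 1 else -1)
        = (if t = -1 then \<psi> t * of_nat (p ^ n) else 0) - \<psi> t"
      by (simp only:) (simp add: right_diff_distrib)
  qed
  also have "\<dots> = \<psi> (-1) * of_nat (p ^ n)"
    unfolding sum_subtractf sum0 by (simp add: sum.delta)
  finally show ?thesis .
qed

end

section \<open>Gauss periods\<close>

locale injective_mult_char = prime_power_field p n F
  for p n :: nat and F :: "'a::{finite,field} itself" +
  fixes \<chi> :: "'a \<Rightarrow> complex" and k m :: nat
  assumes mult_char: "mult_char \<chi>" and inj: "inj_on \<chi> (UNIV - {0})"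
    and k_pos: "k > 0" and km: "k * m = p ^ n - 1"
begin

text \<open>For an \<open>m\<close>-th root of unity \<open>z\<close> this is a coset of the
  multiplicative subgroup of order \<open>k\<close>, so that \<open>gauss_period z\<close> is a
  classical Gauss period. For other \<open>z\<close> it is empty.\<close>

definition fiber :: "complex \<Rightarrow> 'a set" where
  "fiber z = {x. x \<noteq> 0 \<and> \<chi> x ^ k = z}"

definition gauss_period :: "complex \<Rightarrow> complex" where
  "gauss_period z = (\<Sum>x\<in>fiber z. add_char p n x)"

lemma m_pos: "m > 0"
proof (rule ccontr)
  assume "\<not> m > 0"
  hence "p ^ n \<le> 1" using km by simp
  thus False using p_ge_2 n_pos one_less_power[of p n] by simp
qed

lemma unity_root_nonzero: "z ^ m = 1 \<Longrightarrow> z \<noteq> (0 :: complex)"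
  using m_pos by (auto simp: power_0_left)

lemma char_nonzero: "x \<noteq> 0 \<Longrightarrow> \<chi> x \<noteq> 0"
  and char_mult: "x \<noteq> 0 \<Longrightarrow> y \<noteq> 0 \<Longrightarrow> \<chi> (x * y) = \<chi> x * \<chi> y"
  using mult_char unfolding mult_char_def by blast+

lemma char_unity_root: "x \<noteq> 0 \<Longrightarrow> (\<chi> x ^ k) ^ m = 1"
  using mult_char_unity_root[OF mult_char, of x] by (simp add: card_UNIV km flip: power_mult)

text \<open>By injectivity there are \<open>k * m\<close> values, as many as there are roots of
  unity to receive them.\<close>

lemma char_image: "\<chi> ` (UNIV - {0}) = {u. u ^ (k * m) = 1}"
proof (rule card_subset_eq)
  have "card (\<chi> ` (UNIV - {0})) = k * m"
    using inj by (simp add: card_image card_Diff_singleton card_UNIV km)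
  thus "card (\<chi> ` (UNIV - {0})) = card {u :: complex. u ^ (k * m) = 1}"
    using k_pos m_pos by (simp add: card_roots_unity_eq)
  show "finite {u :: complex. u ^ (k * m) = 1}"
    using k_pos m_pos by (intro finite_nth_roots) simp
  show "\<chi> ` (UNIV - {0}) \<subseteq> {u. u ^ (k * m) = 1}"
    using char_unity_root by (auto simp: power_mult)
qed

text \<open>The character maps the fiber bijectively onto the \<open>k\<close>-th roots of
  \<open>z\<close>.\<close>

lemma card_fiber:
  assumes "z ^ m = 1"
  shows "card (fiber z) = k"
proof -
  have "\<chi> ` fiber z = {u. u ^ k = z}"
  proof
    show "{u. u ^ k = z} \<subseteq> \<chi> ` fiber z"
    proof
      fix u assume u: "u \<in> {u. u ^ k = z}"
      hence "u ^ (k * m) = 1" using assms by (simp add: power_mult)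
      hence "u \<in> \<chi> ` (UNIV - {0})" unfolding char_image by simp
      then obtain x where "x \<noteq> 0" "\<chi> x = u" by auto
      thus "u \<in> \<chi> ` fiber z" using u by (auto simp: fiber_def)
    qed
  qed (auto simp: fiber_def)
  moreover have "z \<noteq> 0" using assms by (rule unity_root_nonzero)
  ultimately have "card (\<chi> ` fiber z) = k" using k_pos by (simp add: card_nth_roots)
  moreover have "inj_on \<chi> (fiber z)" by (rule inj_on_subset[OF inj]) (auto simp: fiber_def)
  ultimately show ?thesis by (simp add: card_image)
qed

lemma finite_unity_roots: "finite {z :: complex. z ^ m = 1}"
  by (rule finite_nth_roots[OF m_pos])

lemma char_pow_eq: "char_pow \<chi> (int k * s) x = (if x = 0 then 0 else (\<chi> x ^ k) powi s)"
  by (simp add: char_pow_def power_int_mult)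

text \<open>The summation is grouped by the fibers of \<open>\<chi> ^ k\<close>, on which the
  character is constant.\<close>

lemma gauss_sum_char_pow:
  "gauss_sum p n (char_pow \<chi> (int k * s)) = (\<Sum>z | z ^ m = 1. z powi s * gauss_period z)"
proof -
  have "(\<Sum>z | z ^ m = 1. z powi s * gauss_period z)
      = (\<Sum>z | z ^ m = 1. \<Sum>x\<in>{x\<in>UNIV - {0}. \<chi> x ^ k = z}. (\<chi> x ^ k) powi s * add_char p n x)"
    unfolding gauss_period_def sum_distrib_left by (intro sum.cong refl) (auto simp: fiber_def)
  also have "\<dots> = (\<Sum>x\<in>UNIV - {0}. (\<chi> x ^ k) powi s * add_char p n x)"
    by (rule sum.group) (use finite_unity_roots char_unity_root in auto)
  also have "\<dots> = gauss_sum p n (char_pow \<chi> (int k * s))"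
    by (subst gauss_sum_nonzero) (auto simp: char_pow_eq intro!: sum.cong)
  finally show ?thesis ..
qed

lemma bij_betw_mult_unity_root:
  assumes "c ^ m = 1"
  shows "bij_betw (\<lambda>z. c * z) {z. z ^ m = 1} {z :: complex. z ^ m = 1}"
proof -
  have "c \<noteq> 0" using assms by (rule unity_root_nonzero)
  thus ?thesis
    by (intro bij_betw_byWitness[where f' = "\<lambda>z. z / c"])
      (use assms in \<open>auto simp: power_mult_distrib power_divide\<close>)
qed

lemma bij_betw_divide_unity_root:
  assumes "c ^ m = 1"
  shows "bij_betw (\<lambda>z. c / z) {z. z ^ m = 1} {z :: complex. z ^ m = 1}"
proof -
  have "c \<noteq> 0" using assms by (rule unity_root_nonzero)
  thus ?thesis
    by (intro bij_betw_byWitness[where f' = "\<lambda>z. c / z"])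
      (use assms in \<open>auto simp: power_divide dest: unity_root_nonzero\<close>)
qed

text \<open>The product is the value at \<open>\<zeta>\<close> of an integer polynomial
  \<open>f\<close>. Replacing \<open>\<zeta>\<close> by a conjugate permutes the factors, and at 1
  every period becomes the size \<open>k\<close> of its fiber. The coefficients \<open>a\<close> and
  \<open>b\<close> allow one statement to serve both determinants.\<close>

lemma prod_gauss_period_int:
  fixes a b :: int
  obtains d :: int where
    "(\<Prod>z | z ^ m = 1. of_int a * gauss_period z + of_int b) = of_int d"
    "[d = (a * int k + b) ^ m] (mod int p)"
proof -
  define f :: "complex poly" where
    "f = (\<Prod>z | z ^ m = 1. Polynomial.smult (of_int a) (\<Sum>x\<in>fiber z. Polynomial.monom 1 (trace_nat x)) + [:of_int b:])"
  have poly_f: "poly f y = (\<Prod>z | z ^ m = 1. of_int a * (\<Sum>x\<in>fiber z. y ^ trace_nat x) + of_int b)" for y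
    by (simp add: f_def poly_prod poly_sum poly_monom)
  have coeff_prod: "\<forall>i. poly.coeff (\<Prod>z\<in>S. g z) i \<in> \<int>"
    if "\<And>z i. poly.coeff (g z) i \<in> \<int>" for g :: "complex \<Rightarrow> complex poly" and S
  proof (induction S rule: infinite_finite_induct)
    case (insert z S)
    thus ?case using that by (auto simp: coeff_mult intro!: Ints_sum Ints_mult)
  qed (auto simp: coeff_1)
  have coeffs: "poly.coeff f i \<in> \<int>" for i
    unfolding f_def by (rule coeff_prod[rule_format])
      (auto simp: coeff_sum coeff_pCons split: nat.splits intro!: Ints_add Ints_mult Ints_sum)
  \<comment> \<open>Scaling by \<open>j\<close>, nonzero in the field, carries one fiber onto
    another.\<close>
  have twist: "(\<Sum>x\<in>fiber z. (\<zeta> ^ j) ^ trace_nat x) = gauss_period (\<chi> (of_nat j) ^ k * z)"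
    if j: "0 < j" "j < p" for j z
  proof -
    have j0: "(of_nat j :: 'a) \<noteq> 0"
      using j by (auto simp: of_nat_eq_0_iff_char_dvd CHAR_eq dest: dvd_imp_le)
    have "(\<Sum>x\<in>fiber z. (\<zeta> ^ j) ^ trace_nat x) = (\<Sum>x\<in>fiber z. add_char p n (of_nat j * x))"
      by (simp add: add_char_of_nat_mult)
    also have "\<dots> = (\<Sum>x\<in>fiber (\<chi> (of_nat j) ^ k * z). add_char p n x)"
    proof (rule sum.reindex_bij_witness[of _ "\<lambda>x. x / of_nat j" "\<lambda>x. of_nat j * x"])
      fix x assume "x \<in> fiber z"
      thus "of_nat j * x \<in> fiber (\<chi> (of_nat j) ^ k * z)"
        using j0 by (auto simp: fiber_def char_mult power_mult_distrib)
    next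
      fix x assume x: "x \<in> fiber (\<chi> (of_nat j) ^ k * z)"
      hence x0: "x \<noteq> 0" and eq: "\<chi> x ^ k = \<chi> (of_nat j) ^ k * z" by (auto simp: fiber_def)
      have "\<chi> (of_nat j * (x / of_nat j)) = \<chi> (of_nat j) * \<chi> (x / of_nat j)"
        by (rule char_mult) (use x0 j0 in auto)
      hence "\<chi> (of_nat j) ^ k * \<chi> (x / of_nat j) ^ k = \<chi> (of_nat j) ^ k * z"
        using j0 eq by (simp add: power_mult_distrib)
      thus "x / of_nat j \<in> fiber z"
        using x0 j0 char_nonzero[OF j0] by (auto simp: fiber_def)
    qed (use j0 in auto)
    finally show ?thesis by (simp add: gauss_period_def)
  qed
  have twist_1: "(\<Sum>x\<in>fiber z. \<zeta> ^ trace_nat x) = gauss_period z" for z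
    by (simp add: gauss_period_def add_char_eq)
  have inv: "poly f (\<zeta> ^ j) = poly f \<zeta>" if j: "0 < j" "j < p" for j
  proof -
    have "(of_nat j :: 'a) \<noteq> 0"
      using j by (auto simp: of_nat_eq_0_iff_char_dvd CHAR_eq dest: dvd_imp_le)
    hence bij: "bij_betw (\<lambda>z. \<chi> (of_nat j) ^ k * z) {z. z ^ m = 1} {z. z ^ m = 1}"
      by (intro bij_betw_mult_unity_root char_unity_root)
    show ?thesis
      unfolding poly_f twist[OF j] twist_1
      using prod.reindex_bij_betw[OF bij, of "\<lambda>z. of_int a * gauss_period z + of_int b"] by simp
  qed
  have "\<zeta> ^ p = 1" using p_ge_2 by (intro cis_unity_power_n) simp
  from conjugation_invariant_value[OF prime this coeffs inv] obtain d where
    d: "poly f \<zeta> = of_int d" "\<And>e. poly f 1 = of_int e \<Longrightarrow> [d = e] (mod int p)"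
    by blast
  have "poly f 1 = (\<Prod>z | z ^ m = (1 :: complex). of_int (a * int k + b))"
    unfolding poly_f by (intro prod.cong refl) (simp add: card_fiber)
  also have "\<dots> = of_int ((a * int k + b) ^ m)"
    using m_pos by (simp add: card_roots_unity_eq)
  finally show ?thesis
    using d(1) d(2) by (intro that[of d]) (simp_all add: poly_f twist_1)
qed

section \<open>The two determinants in terms of Gauss periods\<close>

abbreviation det_sign :: "'b::ring_1" where
  "det_sign \<equiv> (-1) ^ ((m - 1) * (m - 2) div 2)"

lemma m_eq: "(p ^ n - 1) div k = m"
  unfolding km[symmetric] using k_pos by simp

lemma det_A_mat: "det (A_mat p n k \<chi>) = det_sign * of_nat m ^ m * (\<Prod>z | z ^ m = 1. gauss_period z)"
proof -
  have "int (k * i + k * j) = int k * int (i + j)" for i j by (simp add: algebra_simps)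
  hence "A_mat p n k \<chi> = mat m m (\<lambda>(i, j). \<Sum>z | z ^ m = 1. z ^ (i + j) * gauss_period z)"
    unfolding A_mat_def Let_def m_eq by (simp only: gauss_sum_char_pow power_int_of_nat)
  thus ?thesis by (simp only: det_power_sum_matrix[OF m_pos])
qed

text \<open>This is the Gauss sum of the trivial character, which vanishes at 0.\<close>

lemma sum_gauss_period: "(\<Sum>z | z ^ m = 1. gauss_period z) = -1"
proof -
  have "(\<Sum>z | z ^ m = 1. gauss_period z) = gauss_sum p n (char_pow \<chi> (int k * 0))"
    by (simp only: gauss_sum_char_pow power_int_0_right mult_1)
  also have "\<dots> = (\<Sum>x\<in>UNIV - {0}. add_char p n (1 * x :: 'a))"
    by (subst gauss_sum_nonzero) (auto simp: char_pow_def intro!: sum.cong)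
  also have "\<dots> = -1" by (subst sum_nonzero_add_char) simp
  finally show ?thesis .
qed

text \<open>If \<open>m\<close> divides \<open>s\<close>, the Gauss sum is -1, and with
  \<open>q = p ^ n\<close> the right side is \<open>-1 / q + (1 - q) / q = -1\<close>. Otherwise the
  constant term sums to 0, and the product formula gives the inverse; the argument
  \<open>c / z\<close> absorbs both the inversion of the character and its value at -1.\<close>

lemma inverse_gauss_sum_char_pow:
  fixes s :: nat
  defines "c \<equiv> \<chi> (-1) ^ k"
  shows "inverse (gauss_sum p n (char_pow \<chi> (int k * int s)))
    = (\<Sum>z | z ^ m = 1. z ^ s * ((of_nat m * gauss_period (c / z) + (1 - of_nat (p ^ n))) / of_nat (p ^ n * m)))"
proof -
  let ?q = "of_nat (p ^ n) :: complex" and ?W = "{z :: complex. z ^ m = 1}"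
  have q0: "?q \<noteq> 0" using p_ge_2 by simp
  have m0: "(of_nat m :: complex) \<noteq> 0" using m_pos by simp
  have cm: "c ^ m = 1" unfolding c_def by (rule char_unity_root) simp
  have c2: "c * c = 1"
  proof -
    have "\<chi> (-1) * \<chi> (-1) = \<chi> ((-1) * (-1))" by (rule char_mult[symmetric]) auto
    also have "\<dots> = 1" using mult_char_1[OF mult_char] by simp
    finally show ?thesis by (simp add: c_def flip: power_mult_distrib)
  qed
  have "(\<Sum>z\<in>?W. z ^ s * ((of_nat m * gauss_period (c / z) + (1 - ?q)) / of_nat (p ^ n * m)))
      = (\<Sum>z\<in>?W. z ^ s * gauss_period (c / z) / ?q + z ^ s * ((1 - ?q) / (?q * of_nat m)))"
    using q0 m0 by (intro sum.cong refl) (simp add: field_simps)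
  also have "\<dots> = (\<Sum>z\<in>?W. z ^ s * gauss_period (c / z)) / ?q + (\<Sum>z\<in>?W. z ^ s) * ((1 - ?q) / (?q * of_nat m))"
    by (simp only: sum.distrib sum_divide_distrib sum_distrib_right)
  also have "\<dots> = inverse (gauss_sum p n (char_pow \<chi> (int k * int s)))"
  proof (cases "m dvd s")
    case True
    have z1: "z ^ s = 1" if "z ^ m = 1" for z :: complex
      using True that by (auto elim!: dvdE simp: power_mult)
    have "(\<Sum>z\<in>?W. z ^ s * gauss_period (c / z)) = (\<Sum>z\<in>?W. gauss_period (c / z))"
      by (intro sum.cong refl) (simp add: z1)
    also have "\<dots> = -1"
      using sum.reindex_bij_betw[OF bij_betw_divide_unity_root[OF cm], of gauss_period]
      by (simp add: sum_gauss_period)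
    finally have 1: "(\<Sum>z\<in>?W. z ^ s * gauss_period (c / z)) = -1" .
    have "gauss_sum p n (char_pow \<chi> (int k * int s)) = (\<Sum>z\<in>?W. gauss_period z)"
      unfolding gauss_sum_char_pow by (intro sum.cong refl) (simp add: z1)
    hence 2: "gauss_sum p n (char_pow \<chi> (int k * int s)) = -1" by (simp add: sum_gauss_period)
    show ?thesis
      unfolding 1 2 using True q0 m0
      by (simp add: sum_powers_roots_unity[OF m_pos] field_simps)
  next
    case False
    let ?\<psi> = "char_pow \<chi> (int k * int s)"
    have \<psi>: "mult_char ?\<psi>"
      unfolding mult_char_def
      by (auto simp: char_pow_eq char_mult char_nonzero power_int_mult_distrib power_mult_distrib)
    \<comment> \<open>A preimage \<open>u\<close> of a primitive \<open>k * m\<close>-th root of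
      unity witnesses nontriviality, since \<open>k * m\<close> does not divide
      \<open>k * s\<close>.\<close>
    have "cis (2 * pi / real (k * m)) \<in> \<chi> ` (UNIV - {0})"
      unfolding char_image using k_pos m_pos by (simp only: mem_Collect_eq) (rule cis_unity_power_n, simp)
    then obtain u where u: "\<chi> u = cis (2 * pi / real (k * m))" "u \<noteq> 0"
      by (rule imageE) simp
    have "?\<psi> u = cis (2 * pi / real (k * m)) ^ (k * s)"
      using u by (simp add: char_pow_eq power_mult)
    hence "?\<psi> u \<noteq> 1"
      using cis_unity_power_eq_1_iff[of "k * m" "k * s"] False k_pos m_pos by simp
    moreover have "?\<psi> (-1) = c ^ s" by (simp add: char_pow_eq c_def)
    ultimately have "gauss_sum p n ?\<psi> * gauss_sum p n (\<lambda>x. inverse (?\<psi> x)) = c ^ s * ?q"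
      using gauss_sum_mult_inverse[OF \<psi> u(2)] by simp
    moreover have "(\<lambda>x. inverse (?\<psi> x)) = char_pow \<chi> (int k * (- int s))"
      by (rule ext) (simp add: char_pow_eq power_int_minus del: mult_minus_right)
    ultimately have prod: "gauss_sum p n ?\<psi> * gauss_sum p n (char_pow \<chi> (int k * (- int s))) = c ^ s * ?q"
      by simp
    have "c ^ s * gauss_sum p n (char_pow \<chi> (int k * (- int s))) = (\<Sum>z\<in>?W. (c / z) ^ s * gauss_period z)"
      unfolding gauss_sum_char_pow sum_distrib_left
      by (intro sum.cong refl) (simp add: power_int_minus power_mult_distrib power_inverse divide_inverse)
    also have "\<dots> = (\<Sum>z\<in>?W. (c / (c / z)) ^ s * gauss_period (c / z))"
      by (rule sum.reindex_bij_betw[OF bij_betw_divide_unity_root[OF cm], symmetric])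
    also have "\<dots> = (\<Sum>z\<in>?W. z ^ s * gauss_period (c / z))"
      using c2 by (intro sum.cong refl) auto
    finally have sum: "(\<Sum>z\<in>?W. z ^ s * gauss_period (c / z)) = c ^ s * gauss_sum p n (char_pow \<chi> (int k * (- int s)))" ..
    have "gauss_sum p n ?\<psi> * (c ^ s * gauss_sum p n (char_pow \<chi> (int k * (- int s)))) = c ^ s * (c ^ s * ?q)"
      unfolding prod[symmetric] by (simp only: mult_ac)
    also have "\<dots> = (c * c) ^ s * ?q" by (simp only: power_mult_distrib mult_ac)
    also have "\<dots> = ?q" by (simp add: c2)
    finally have "inverse (gauss_sum p n ?\<psi>) = c ^ s * gauss_sum p n (char_pow \<chi> (int k * (- int s))) / ?q"
      using q0 by (intro inverse_unique) simp
    thus ?thesis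
      unfolding sum using False by (simp add: sum_powers_roots_unity[OF m_pos])
  qed
  finally show ?thesis ..
qed

text \<open>The factor \<open>m ^ m\<close> cancels against the denominators, and \<open>c\<close>
  disappears because \<open>z \<mapsto> c / z\<close> permutes the roots of unity.\<close>

lemma det_B_mat:
  "det (B_mat p n k \<chi>) = det_sign * (\<Prod>z | z ^ m = 1. of_nat m * gauss_period z + (1 - of_nat (p ^ n))) / of_nat (p ^ n) ^ m"
proof -
  let ?c = "\<chi> (-1) ^ k" and ?q = "of_nat (p ^ n) :: complex"
  have "int (k * i + k * j) = int k * int (i + j)" for i j by (simp add: algebra_simps)
  hence "B_mat p n k \<chi> = mat m m (\<lambda>(i, j). \<Sum>z | z ^ m = 1.
      z ^ (i + j) * ((of_nat m * gauss_period (?c / z) + (1 - ?q)) / of_nat (p ^ n * m)))"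
    unfolding B_mat_def Let_def m_eq by (simp only: inverse_gauss_sum_char_pow)
  hence "det (B_mat p n k \<chi>) = det_sign * of_nat m ^ m *
      (\<Prod>z | z ^ m = 1. (of_nat m * gauss_period (?c / z) + (1 - ?q)) / of_nat (p ^ n * m))"
    by (simp only: det_power_sum_matrix[OF m_pos])
  also have "(\<Prod>z | z ^ m = 1. (of_nat m * gauss_period (?c / z) + (1 - ?q)) / of_nat (p ^ n * m))
      = (\<Prod>z | z ^ m = 1. of_nat m * gauss_period (?c / z) + (1 - ?q)) / of_nat (p ^ n * m) ^ m"
    using m_pos by (simp add: prod_dividef card_roots_unity_eq)
  also have "(\<Prod>z | z ^ m = 1. of_nat m * gauss_period (?c / z) + (1 - ?q))
      = (\<Prod>z | z ^ m = 1. of_nat m * gauss_period z + (1 - ?q))"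
  proof -
    have "?c ^ m = 1" by (rule char_unity_root) simp
    from prod.reindex_bij_betw[OF bij_betw_divide_unity_root[OF this]] show ?thesis .
  qed
  finally show ?thesis using m_pos by (simp add: power_mult_distrib field_simps)
qed

text \<open>The periods of a power \<open>\<chi>'\<close> of \<open>\<chi>\<close> are those of \<open>\<chi>\<close>, permuted by \<open>z \<mapsto> z powi r\<close>.\<close>

lemma prod_gauss_period_char_pow:
  fixes h :: "complex \<Rightarrow> complex"
  assumes "injective_mult_char p n \<chi>' k m" and pow: "\<chi>' = char_pow \<chi> r"
  shows "(\<Prod>z | z ^ m = 1. h (injective_mult_char.gauss_period p n \<chi>' k z)) = (\<Prod>z | z ^ m = 1. h (gauss_period z))"
proof -
  interpret other: injective_mult_char p n F \<chi>' k m by (rule assms(1))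
  have unity: "(z powi r) ^ m = 1" if "z ^ m = 1" for z :: complex
    by (metis power_int_1_left power_int_mult power_int_of_nat mult.commute that)
  \<comment> \<open>One inclusion is enough, as both fibers have \<open>k\<close> elements.\<close>
  have fiber: "fiber z = other.fiber (z powi r)" if z: "z ^ m = 1" for z
  proof (rule card_subset_eq)
    show "fiber z \<subseteq> other.fiber (z powi r)"
    proof
      fix x assume x: "x \<in> fiber z"
      hence "\<chi>' x ^ k = (\<chi> x ^ k) powi r"
        unfolding pow by (simp add: char_pow_def fiber_def)
          (metis power_int_mult power_int_of_nat mult.commute)
      thus "x \<in> other.fiber (z powi r)" using x by (simp add: fiber_def other.fiber_def)
    qed
    show "card (fiber z) = card (other.fiber (z powi r))"
      by (simp only: card_fiber[OF z] other.card_fiber[OF unity[OF z]])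
  qed simp
  \<comment> \<open>Equal powers give equal fibers, and a nonempty fiber determines its index; no
    arithmetic of \<open>r\<close> enters.\<close>
  have "inj_on (\<lambda>z. z powi r) {z :: complex. z ^ m = 1}"
  proof (rule inj_onI)
    fix y z :: complex assume yz: "y \<in> {z. z ^ m = 1}" "z \<in> {z. z ^ m = 1}" "y powi r = z powi r"
    hence eq: "fiber y = fiber z" using fiber[of y] fiber[of z] by simp
    have "card (fiber y) \<noteq> 0" using card_fiber[of y] k_pos yz by simp
    then obtain x where "x \<in> fiber y" by fastforce
    moreover from this have "x \<in> fiber z" unfolding eq .
    ultimately show "y = z" unfolding fiber_def by blast
  qed
  hence bij: "bij_betw (\<lambda>z. z powi r) {z. z ^ m = 1} {z :: complex. z ^ m = 1}"
    unfolding bij_betw_def using unity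
    by (intro conjI endo_inj_surj finite_unity_roots) auto
  have "(\<Prod>z | z ^ m = 1. h (gauss_period z)) = (\<Prod>z | z ^ m = 1. h (other.gauss_period (z powi r)))"
    by (intro prod.cong refl) (simp add: gauss_period_def other.gauss_period_def fiber)
  also have "\<dots> = (\<Prod>z | z ^ m = 1. h (other.gauss_period z))"
    by (rule prod.reindex_bij_betw[OF bij])
  finally show ?thesis ..
qed

end

theorem theorem1p1:
  fixes \<chi> :: "'a::{finite,field} \<Rightarrow> complex" and p n k :: nat
  assumes "prime p" and "n > 0" and "card (UNIV :: 'a set) = p ^ n"
    and "char_generator \<chi>"
    and "k > 0" and "k dvd p ^ n - 1"
  defines "m \<equiv> (p ^ n - 1) div k"
  shows "det (A_mat p n k \<chi>) \<in> \<int> \<and> det (B_mat p n k \<chi>) \<in> \<rat>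
     \<and> (\<forall>\<chi>' :: 'a \<Rightarrow> complex. char_generator \<chi>' \<longrightarrow>
          det (A_mat p n k \<chi>') = det (A_mat p n k \<chi>) \<and> det (B_mat p n k \<chi>') = det (B_mat p n k \<chi>))
     \<and> (\<exists>d::int. det (A_mat p n k \<chi>) = of_int d \<and>
          d mod int p = (-1) ^ ((m * m - m + 2) div 2) mod int p)"
proof -
  have km: "k * m = p ^ n - 1" using assms by simp
  have locale_inst: "injective_mult_char p n \<chi>' k m" if "char_generator \<chi>'" for \<chi>' :: "'a \<Rightarrow> complex"
    using assms km that char_generator_inj[OF that]
    by unfold_locales (auto simp: char_generator_def)
  interpret injective_mult_char p n "TYPE('a)" \<chi> k m by (rule locale_inst) fact

  obtain d where d: "(\<Prod>z | z ^ m = 1. gauss_period z) = of_int d" "[d = int k ^ m] (mod int p)"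
    by (rule prod_gauss_period_int[of 1 0]) auto
  define D where "D = det_sign * int m ^ m * d"
  have det_A: "det (A_mat p n k \<chi>) = of_int D"
    by (simp add: det_A_mat d(1) D_def)
  have "[D = det_sign * int m ^ m * int k ^ m] (mod int p)"
    unfolding D_def by (intro cong_mult cong_refl d(2))
  \<comment> \<open>The factor \<open>m ^ m\<close> of the determinant joins \<open>k ^ m\<close>
    from the periods to form a power of \<open>p ^ n - 1\<close>, which is -1 modulo
    \<open>p\<close>.\<close>
  also have "det_sign * int m ^ m * int k ^ m = det_sign * int (p ^ n - 1) ^ m"
    unfolding km[symmetric] by (simp add: power_mult_distrib mult_ac)
  also have "[\<dots> = det_sign * (-1) ^ m] (mod int p)"
  proof (intro cong_mult cong_refl cong_pow)
    have "int (p ^ n - 1) - (-1) = int (p ^ n)"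
      using p_ge_2 by (simp add: of_nat_diff)
    thus "[int (p ^ n - 1) = -1] (mod int p)"
      using n_pos by (simp add: cong_iff_dvd_diff dvd_power)
  qed
  also have "det_sign * (-1) ^ m = ((-1) ^ ((m * m - m + 2) div 2) :: int)"
  proof -
    \<comment> \<open>With \<open>m = Suc l\<close> the truncated differences \<open>m - 1\<close>
      and \<open>m - 2\<close> become \<open>l\<close> and \<open>l - 1\<close>, so
      \<open>m = 1\<close> is covered too.\<close>
    obtain l where l: "m = Suc l" using m_pos by (cases m) auto
    have "(m - 1) * (m - 2) div 2 + m = (l * (l - 1) + 2 * l + 2) div 2" by (simp add: l)
    also have "l * (l - 1) + 2 * l + 2 = m * m - m + 2"
      by (cases l) (simp_all add: l algebra_simps)
    finally show ?thesis by (simp flip: power_add)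
  qed
  finally have cong: "[D = (-1) ^ ((m * m - m + 2) div 2)] (mod int p)" .

  \<comment> \<open>The weights of \<open>B_mat\<close> with denominators cleared:
    \<open>a = m\<close> and \<open>b = 1 - p ^ n\<close>.\<close>
  obtain e where "(\<Prod>z | z ^ m = 1. of_int (int m) * gauss_period z + of_int (1 - int (p ^ n))) = of_int e"
    by (rule prod_gauss_period_int)
  hence "det (B_mat p n k \<chi>) = det_sign * of_int e / of_nat (p ^ n) ^ m"
    by (simp add: det_B_mat)
  also have "\<dots> \<in> \<rat>" by (intro Rats_divide Rats_mult Rats_power) auto
  finally have det_B: "det (B_mat p n k \<chi>) \<in> \<rat>" .

  have indep: "det (A_mat p n k \<chi>') = det (A_mat p n k \<chi>)" "det (B_mat p n k \<chi>') = det (B_mat p n k \<chi>)"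
    if gen: "char_generator \<chi>'" for \<chi>' :: "'a \<Rightarrow> complex"
  proof -
    interpret other: injective_mult_char p n "TYPE('a)" \<chi>' k m by (rule locale_inst) fact
    obtain r where "\<chi>' = char_pow \<chi> r"
      using assms(4) gen unfolding char_generator_def by blast
    note periods = prod_gauss_period_char_pow[OF locale_inst[OF gen] this]
    show "det (A_mat p n k \<chi>') = det (A_mat p n k \<chi>)"
      unfolding det_A_mat other.det_A_mat using periods[of "\<lambda>z. z"] by simp
    show "det (B_mat p n k \<chi>') = det (B_mat p n k \<chi>)"
      unfolding det_B_mat other.det_B_mat
      using periods[of "\<lambda>z. of_nat m * z + (1 - of_nat (p ^ n))"] by simp
  qed
  show ?thesis
    using det_A det_B indep cong by (auto simp: cong_def)
qed

end
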